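(* Let $d$ be a positive integer. If there exists a positive integer $k$ such that $$\frac{p_{k+1}^2-2}{h(k)+1} \ge d,$$ then for every integer $a$ with $\gcd(a,d)=1$, the set $a+d\mathbb{Z}=\{a+dn : n\in\mathbb{Z}\}$ contains at least one (positive) prime.
   Context: $p_j$ denotes the $j$th prime ($p_1=2,p_2=3,\dots$). The primorial is $p_k\# = \prod_{j=1}^k p_j$. For a positive integer $n$, the Jacobsthal function $g(n)$ is the smallest positive integer $m$ such that every sequence of $m$ consecutive integers contains at least one integer coprime to $n$. The primorial Jacobsthal function is $h(k)=g(p_k\#)$. "Prime" means positive prime. *)

theory Defs
  imports Complex_Main "HOL-Library.Infinite_Set" "HOL-Computational_Algebra.Primes"
begin

text \<open>The primes are indexed from 1, while \<^const>\<open>enumerate\<close> counts from 0;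
  the value at index 0 is irrelevant.\<close>

definition nth_prime :: "nat \<Rightarrow> nat" where
  "nth_prime j = enumerate {p. prime p} (j - 1)"

definition primorial :: "nat \<Rightarrow> nat" where
  "primorial k = (\<Prod>j = 1..k. nth_prime j)"

definition jacobsthal :: "nat \<Rightarrow> nat" where
  "jacobsthal n =
     (LEAST m. m > 0 \<and> (\<forall>a::int. \<exists>x\<in>{a..<a + int m}. coprime x (int n)))"

definition primorial_jacobsthal :: "nat \<Rightarrow> nat" where
  "primorial_jacobsthal k = jacobsthal (primorial k)"

end

theory Submission
  imports Defs "HOL-Number_Theory.Pocklington"
begin

text \<open>Multiplication by an inverse of \<open>d\<close> modulo the part of \<open>N\<close> that is coprime to \<open>d\<close> turns the
  progression \<open>a + d * n\<close> into a run of consecutive integers, and the primes dividing \<open>d\<close> never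
  divide a term. Hence any \<open>jacobsthal N\<close> successive terms contain one coprime to \<open>N\<close>.
  Apply this with \<open>N = p\<^sub>k#\<close> to the terms starting at the least one that exceeds 1: all of them are
  below \<open>p\<^sub>k\<^sub>+\<^sub>1\<^sup>2\<close>, so the one coprime to \<open>N\<close> has no room for two prime factors.\<close>

lemma prime_nth_prime: "prime (nth_prime j)"
  using enumerate_in_set[OF primes_infinite] by (simp add: nth_prime_def)

lemma primorial_pos: "primorial k > 0"
  by (simp add: primorial_def prod_pos prime_gt_0_nat prime_nth_prime)

text \<open>If \<open>r\<close> has zero-based index \<open>i\<close> among the primes, then
  \<open>r\<close> is \<open>nth_prime (i + 1)\<close>, which is a factor of
  \<open>primorial k\<close> as soon as \<open>i < k\<close>.\<close>

lemma nth_prime_le_if_not_dvd_primorial: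
  assumes "prime r" "\<not> r dvd primorial k"
  shows "nth_prime (k + 1) \<le> r"
proof -
  obtain i where i: "enumerate {p. prime p} i = r"
    using enumerate_Ex[OF primes_infinite] assms(1) by blast
  have "k \<le> i"
  proof (rule ccontr)
    assume "\<not> k \<le> i"
    then have "nth_prime (i + 1) dvd primorial k"
      unfolding primorial_def by (intro dvd_prodI) auto
    then show False
      using i assms(2) by (simp add: nth_prime_def)
  qed
  then show ?thesis
    using i enumerate_mono_le_iff[OF primes_infinite, of k i] by (simp add: nth_prime_def)
qed

text \<open>The \<open>LEAST\<close> in \<open>jacobsthal\<close> is attained because
  \<open>n\<close> itself qualifies: any \<open>n\<close> consecutive integers include one congruent
  to 1 modulo \<open>n\<close>.\<close>

lemma ex_coprime_jacobsthal:
  assumes "n > 0"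
  shows "\<exists>x\<in>{a..<a + int (jacobsthal n)}. coprime x (int n)"
proof -
  let ?P = "\<lambda>m. m > 0 \<and> (\<forall>a::int. \<exists>x\<in>{a..<a + int m}. coprime x (int n))"
  have "\<exists>x\<in>{b..<b + int n}. coprime x (int n)" for b :: int
  proof
    let ?x = "b + (1 - b) mod int n"
    show "?x \<in> {b..<b + int n}"
      using assms by simp
    have "[?x = 1] (mod int n)"
      by (simp add: cong_def mod_simps)
    then show "coprime ?x (int n)"
      using cong_imp_coprime cong_sym coprime_1_left by blast
  qed
  then have "?P n"
    using assms by simp
  then have "?P (jacobsthal n)"
    unfolding jacobsthal_def by (rule LeastI)
  then show ?thesis
    by blast
qed

lemma ex_coprime_arith_progression:
  fixes a d s :: int
  assumes "n > 0" "coprime a d"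
  shows "\<exists>i\<in>{s..<s + int (jacobsthal n)}. coprime (a + d * i) (int n)"
proof -
  define M where "M = \<Prod>{r \<in> prime_factors (int n). \<not> r dvd d}"
  have "coprime d M"
    unfolding M_def
    by (intro prod_coprime_right) (auto simp: coprime_commute intro: prime_imp_coprime)
  then obtain e where e: "[d * e = 1] (mod M)"
    using cong_solve_coprime_int by blast
  \<comment> \<open>The window is shifted by \<open>a * e\<close> so that
    \<open>i = x - a * e\<close> falls in the required range; since \<open>d * e\<close> is 1 modulo
    \<open>M\<close>, the term \<open>a + d * i\<close> is then congruent to \<open>d * x\<close>
    modulo \<open>M\<close>.\<close>
  obtain x where x: "x \<in> {s + a * e..<s + a * e + int (jacobsthal n)}" "coprime x (int n)"
    using ex_coprime_jacobsthal[OF assms(1)] by blast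
  have "coprime (a + d * (x - a * e)) (int n)"
  proof (rule ccontr)
    assume "\<not> coprime (a + d * (x - a * e)) (int n)"
    then obtain c where c: "c dvd a + d * (x - a * e)" "c dvd int n" "\<not> is_unit c"
      by (rule not_coprimeE)
    have "c \<noteq> 0"
      using c(2) assms(1) by auto
    then obtain r where "prime r" "r dvd c"
      using prime_divisor_exists[of c] c(3) by blast
    then have r: "prime r" "r dvd a + d * (x - a * e)" "r dvd int n"
      using c(1,2) by (auto intro: dvd_trans)
    show False
    proof (cases "r dvd d")
      case True
      then have "r dvd a"
        using r(2) dvd_add_left_iff[of r "d * (x - a * e)" a] by simp
      then show False
        using True r(1) coprime_common_divisor[OF assms(2), of r] not_prime_unit by blast
    next
      case False
      then have "r dvd M"
        unfolding M_def using r assms(1)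
        by (intro dvd_prod_eqI[of _ r]) (simp_all add: in_prime_factors_iff)
      then have "r dvd d * e - 1"
        using e dvd_trans[of r M] by (simp add: cong_iff_dvd_diff)
      then have "r dvd (a + d * (x - a * e)) + a * (d * e - 1)"
        by (rule dvd_add[OF r(2) dvd_mult])
      also have "(a + d * (x - a * e)) + a * (d * e - 1) = d * x"
        by (simp add: algebra_simps)
      finally have "r dvd d * x" .
      then have "r dvd x"
        using False r(1) by (simp add: prime_dvd_mult_iff)
      then show False
        using r coprime_common_divisor[OF x(2), of r] not_prime_unit by blast
    qed
  qed
  then show ?thesis
    using x(1) by (intro bexI[of _ "x - a * e"]) auto
qed

text \<open>A composite \<open>m\<close> has a prime factor \<open>r\<close> with
  \<open>r ^ 2 \<le> m\<close>, but coprimality forces every prime factor up to at least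
  \<open>nth_prime (k + 1)\<close>.\<close>

lemma prime_if_coprime_primorial:
  assumes "coprime m (primorial k)" "1 < m" "m < nth_prime (k + 1) ^ 2"
  shows "prime m"
proof (rule ccontr)
  assume "\<not> prime m"
  then obtain r where r: "prime r" "r dvd m" "r ^ 2 \<le> m"
    using assms(2) prime_prime_factor_sqrt[of m] by auto
  have "\<not> r dvd primorial k"
    using r coprime_common_divisor[OF assms(1), of r] not_prime_unit by blast
  then have "nth_prime (k + 1) ^ 2 \<le> r ^ 2"
    using r(1) by (intro power_mono nth_prime_le_if_not_dvd_primorial) auto
  then show False
    using r(3) assms(3) by linarith
qed

theorem theorem2p9:
  fixes d :: int
  assumes "d > 0"
    and "\<exists>k::nat. k > 0 \<and>
           (real (nth_prime (k + 1)) ^ 2 - 2) / (real (primorial_jacobsthal k) + 1) \<ge> of_int d"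
  shows "\<forall>a::int. coprime a d \<longrightarrow> (\<exists>q \<in> {a + d * n | n::int. True}. prime q)"
proof (intro allI impI)
  fix a :: int
  assume a: "coprime a d"
  obtain k where
    k: "(real (nth_prime (k + 1)) ^ 2 - 2) / (real (primorial_jacobsthal k) + 1) \<ge> of_int d"
    using assms(2) by blast
  define p where "p = nth_prime (k + 1)"
  define h where "h = primorial_jacobsthal k"
  have "real_of_int d * (real h + 1) \<le> real p ^ 2 - 2"
    using k by (simp add: pos_le_divide_eq p_def h_def)
  then have "real_of_int (d * (int h + 1)) \<le> real_of_int (int p ^ 2 - 2)"
    by simp
  then have bound: "d * (int h + 1) \<le> int p ^ 2 - 2"
    by (simp only: of_int_le_iff)
  \<comment> \<open>This is the least index whose term is at least 2; that term exceeds 2 by the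
    remainder of \<open>a - 2\<close> modulo \<open>d\<close>.\<close>
  define s where "s = - ((a - 2) div d)"
  have "a + d * s = 2 + (a - 2) mod d"
    by (simp add: s_def minus_div_mult_eq_mod[symmetric] algebra_simps)
  then have s_lower: "2 \<le> a + d * s" and s_upper: "a + d * s < 2 + d"
    using assms(1) by simp_all
  obtain i where i: "s \<le> i" "i < s + int h" "coprime (a + d * i) (int (primorial k))"
    using ex_coprime_arith_progression[OF primorial_pos a, of s k]
    by (auto simp: h_def primorial_jacobsthal_def)
  define q where "q = a + d * i"
  have "d * s \<le> d * i"
    using i(1) assms(1) by simp
  then have lower: "1 < q"
    using s_lower by (simp add: q_def)
  \<comment> \<open>The last admissible index is \<open>s + h - 1\<close>, so
    \<open>q < 2 + d * h\<close>, and \<open>bound\<close> puts this below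
    \<open>p ^ 2\<close>.\<close>
  have "d * i \<le> d * (s + int h - 1)"
    using i(2) assms(1) by simp
  then have upper: "q < int p ^ 2"
    using s_upper bound assms(1) by (simp add: q_def algebra_simps)
  have "prime (nat q)"
  proof (rule prime_if_coprime_primorial[of _ k])
    show "coprime (nat q) (primorial k)"
      using i(3) lower coprime_int_iff[of "nat q"] by (simp add: q_def)
    show "1 < nat q"
      using lower by simp
    show "nat q < nth_prime (k + 1) ^ 2"
      using upper lower by (simp add: p_def nat_less_iff)
  qed
  then have "prime q"
    using lower by (subst prime_int_nat_transfer) simp
  then show "\<exists>q \<in> {a + d * n | n::int. True}. prime q"
    by (auto simp: q_def)
qed

end
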